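(* Let $N$ be a positive integer and let $a,b$ be real parameters such that no denominator appearing below or in the context (for both parameter values $a$ and $a+1$) vanishes. Write $\mathcal U_m(n;a):=\mathcal U_m(n;a,b,N;q)$ for the rational functions of $q$-Hahn type. They satisfy the following contiguity relations for $m,n=0,1,\dots,N$: $$[a]_q\,\mathcal U_m(n;a+1)=[a-n]_q\,\mathcal U_m(n;a)-q^a[-n]_q\,\mathcal U_m(n-1;a),$$ and $$-\frac{[a]_q[2m+b-N]_q}{[a-n]_q}\,\mathcal U_m(n;a+1)=\mathcal A_m\,\mathcal U_{m+1}(n;a)-\big(\mathcal A_m+\mathcal C_m+(1-q^a)[2m+b-N]_q\big)\,\mathcal U_m(n;a)+\mathcal C_m\,\mathcal U_{m-1}(n;a),$$ where $$\mathcal A_m=q^{a+m}\frac{[-m-b-1]_q[m+b-N]_q}{[N-2m-b-1]_q},\qquad \mathcal C_m=q^a\frac{[m]_q[m-N-1]_q}{[2m+b-N-1]_q}.$$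
   Context: $q$ is real, $q>0$, $q\ne1$; $[x]_q=\frac{1-q^x}{1-q}$; $(a;q)_0=1$, $(a;q)_k=\prod_{i=0}^{k-1}(1-aq^i)$. For $m=0,\dots,N$, $$\mathcal U_m(x;a,b,N;q)=q^{m(N-m-b)}\frac{(q^{-N};q)_m}{(q^{-m-b};q)_m}\sum_{k=0}^m\frac{(q^{-m};q)_k(q^{-x};q)_k(q^{b+m-N};q)_k}{(q^{-N};q)_k(q^{a-x};q)_k}\frac{q^k}{(q;q)_k}.$$ Conventions at the ends: $\mathcal U_{N+1}(n;a)=0$ for $n=0,\dots,N$ (because of the factor $(q^{-N};q)_{N+1}=0$); the term with $\mathcal U_{-1}$ is absent since $\mathcal C_0=0$; for $n=0$ the term with $\mathcal U_m(-1;a)$ has coefficient $0$. The nonvanishing of denominators holds for instance if $a$ and $b$ are not integers. *)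

theory Defs
  imports Complex_Main
begin

definition qnum :: "real \<Rightarrow> real \<Rightarrow> real" where
  "qnum q x = (1 - q powr x) / (1 - q)"

definition qpoch :: "real \<Rightarrow> real \<Rightarrow> nat \<Rightarrow> real" where
  "qpoch c q k = (\<Prod>i<k. 1 - c * q ^ i)"

(* The rational function U_m(x; a, b, N; q) of q-Hahn type.  The intended range is m \<le> N.
   At m = N + 1 the prefactor (q^(-N); q)_(N+1) is zero, so this term has the value
   U_(N+1) = 0 required by the usual end convention (see qhahn_U_Suc below), although the
   last summand then has a vanishing denominator. *)
definition qhahn_U :: "real \<Rightarrow> nat \<Rightarrow> real \<Rightarrow> nat \<Rightarrow> real \<Rightarrow> real \<Rightarrow> real" where
  "qhahn_U q N b m x a =
     q powr (real m * (real N - real m - b))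
     * (qpoch (q powr (- real N)) q m / qpoch (q powr (- real m - b)) q m)
     * (\<Sum>k=0..m.
          (qpoch (q powr (- real m)) q k * qpoch (q powr (- x)) q k
             * qpoch (q powr (b + real m - real N)) q k)
          / (qpoch (q powr (- real N)) q k * qpoch (q powr (a - x)) q k)
          * (q ^ k / qpoch q q k))"

definition qhahn_A :: "real \<Rightarrow> nat \<Rightarrow> real \<Rightarrow> real \<Rightarrow> nat \<Rightarrow> real" where
  "qhahn_A q N a b m =
     q powr (a + real m)
     * (qnum q (- real m - b - 1) * qnum q (real m + b - real N)
        / qnum q (real N - 2 * real m - b - 1))"

definition qhahn_C :: "real \<Rightarrow> nat \<Rightarrow> real \<Rightarrow> real \<Rightarrow> nat \<Rightarrow> real" where
  "qhahn_C q N a b m =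
     q powr a
     * (qnum q (real m) * qnum q (real m - real N - 1)
        / qnum q (2 * real m + b - real N - 1))"

lemma qhahn_U_Suc:
  assumes "q > 0"
  shows "qhahn_U q N b (Suc N) x a = 0"
proof -
  have "q powr (- real N) * q ^ N = 1"
    using assms by (simp add: powr_minus powr_realpow)
  then have "qpoch (q powr (- real N)) q (Suc N) = 0"
    by (simp add: qpoch_def)
  then show ?thesis
    by (simp add: qhahn_U_def)
qed

lemma qhahn_C_0:
  assumes "q > 0"
  shows "qhahn_C q N a b 0 = 0"
  using assms by (simp add: qhahn_C_def qnum_def)

end

theory Submission
  imports Defs
begin

text \<open>
  Put \<open>u = q\<^sup>-\<^sup>n\<close>, \<open>\<alpha> = q\<^sup>a\<close> and \<open>\<phi>\<^sub>k = (u; q)\<^sub>k / (\<alpha> u; q)\<^sub>k\<close>.  Up to a prefactor, \<open>U\<^sub>m\<close> is a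
  combination of the \<open>\<phi>\<^sub>k\<close> whose coefficients depend on neither \<open>u\<close> nor \<open>\<alpha>\<close>.  The first relation
  holds summand by summand.  For the second one,
  \<open>(1 - \<alpha>) \<phi>\<^sub>k / (1 - \<alpha> u q\<^sup>k) = \<phi>\<^sub>k - \<alpha> \<phi>\<^sub>k\<^sub>+\<^sub>1\<close> expands \<open>U\<^sub>m(n; a + 1)\<close> in the \<open>\<phi>\<^sub>k\<close> as well; comparing
  coefficients of \<open>\<phi>\<^sub>k\<close>, the parameter \<open>\<alpha>\<close> drops out and a three-term recurrence in \<open>m\<close> for the
  coefficients remains, which is a rational identity in \<open>q\<^sup>m\<close> and \<open>q\<^sup>k\<close>.
\<close>

section \<open>Elementary facts on q-shifted factorials\<close>

lemma qpoch_0 [simp]: "qpoch c q 0 = 1"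
  by (simp add: qpoch_def)

lemma qpoch_Suc: "qpoch c q (Suc k) = qpoch c q k * (1 - c * q ^ k)"
  by (simp add: qpoch_def)

lemma qpoch_Suc_shift: "qpoch c q (Suc k) = (1 - c) * qpoch (c * q) q k"
  unfolding qpoch_def prod.lessThan_Suc_shift by (simp add: mult.assoc)

lemma qpoch_eq_0:
  assumes "c * q ^ i = 1" and "i < k"
  shows "qpoch c q k = 0"
  using assms by (auto simp: qpoch_def)

lemma qpoch_self_nonzero:
  assumes "q > 0" and "q \<noteq> 1"
  shows "qpoch q q k \<noteq> 0"
proof -
  have "q * q ^ i \<noteq> 1" for i
    using assms power_eq_iff_eq_base[of "Suc i" q 1] by simp
  then show ?thesis
    by (simp add: qpoch_def)
qed

text \<open>
  Below \<open>M\<close>, \<open>\<nu>\<close>, \<open>\<beta>\<close> stand for \<open>q\<^sup>m\<close>, \<open>q\<^sup>-\<^sup>N\<close>, \<open>q\<^sup>b\<^sup>-\<^sup>N\<close>.  Then \<open>rec_A\<close> and \<open>rec_C\<close> are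
  \<open>(1 - q) q\<^sup>-\<^sup>a\<close> times \<open>A\<^sub>m\<close> and \<open>C\<^sub>m\<close>, while \<open>rec_up\<close> and \<open>rec_down\<close> are the same two numbers times the
  ratio of the prefactor of \<open>U\<^sub>m\<^sub>+\<^sub>1\<close>, respectively \<open>U\<^sub>m\<^sub>-\<^sub>1\<close>, to that of \<open>U\<^sub>m\<close>.
\<close>

definition qhahn_coeff :: "real \<Rightarrow> real \<Rightarrow> real \<Rightarrow> real \<Rightarrow> nat \<Rightarrow> real" where
  "qhahn_coeff q \<nu> \<beta> M k =
     qpoch (1 / M) q k * qpoch (\<beta> * M) q k / (qpoch \<nu> q k * qpoch q q k) * q ^ k"

definition rec_A :: "real \<Rightarrow> real \<Rightarrow> real \<Rightarrow> real \<Rightarrow> real" where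
  "rec_A q \<nu> \<beta> M = - (M\<^sup>2 * (1 - \<beta> * M) * (\<beta> * M * q - \<nu>) / (1 - \<beta> * M\<^sup>2 * q))"

definition rec_C :: "real \<Rightarrow> real \<Rightarrow> real \<Rightarrow> real \<Rightarrow> real" where
  "rec_C q \<nu> \<beta> M = (1 - M) * (q - M * \<nu>) / (q - \<beta> * M\<^sup>2)"

definition rec_up :: "real \<Rightarrow> real \<Rightarrow> real \<Rightarrow> real \<Rightarrow> real" where
  "rec_up q \<nu> \<beta> M = - (M * (1 - \<beta> * M) * (1 - M * \<nu>) / (1 - \<beta> * M\<^sup>2 * q))"

definition rec_down :: "real \<Rightarrow> real \<Rightarrow> real \<Rightarrow> real \<Rightarrow> real" where
  "rec_down q \<nu> \<beta> M = (1 - M) * M * (\<beta> * M - \<nu>) / (q - \<beta> * M\<^sup>2)"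

section \<open>Three-term recurrence for the coefficients of the \<phi>_k\<close>

lemma qhahn_coeff_0 [simp]: "qhahn_coeff q \<nu> \<beta> M 0 = 1"
  by (simp add: qhahn_coeff_def)

text \<open>This is the comparison of coefficients at k = 0, where all three
  \<open>qhahn_coeff\<close> values are 1 and the shifted sum contributes nothing.\<close>

lemma rec_sum:
  assumes "1 - \<beta> * M\<^sup>2 * q \<noteq> 0" and "q - \<beta> * M\<^sup>2 \<noteq> 0"
  shows "rec_up q \<nu> \<beta> M - (rec_A q \<nu> \<beta> M + rec_C q \<nu> \<beta> M - (1 - \<beta> * M\<^sup>2)) + rec_down q \<nu> \<beta> M = 0"
proof -
  \<comment> \<open>Each reciprocal becomes a variable with a polynomial defining relation, so that
    \<open>algebra\<close> only has to derive a polynomial identity.\<close>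
  define r s where "r = 1 / (1 - \<beta> * M\<^sup>2 * q)" and "s = 1 / (q - \<beta> * M\<^sup>2)"
  have r: "r * (1 - \<beta> * M\<^sup>2 * q) = 1" and s: "s * (q - \<beta> * M\<^sup>2) = 1"
    using assms by (simp_all add: r_def s_def)
  have "rec_A q \<nu> \<beta> M = - (M\<^sup>2 * (1 - \<beta> * M) * (\<beta> * M * q - \<nu>) * r)"
    and "rec_up q \<nu> \<beta> M = - (M * (1 - \<beta> * M) * (1 - M * \<nu>) * r)"
    and "rec_C q \<nu> \<beta> M = (1 - M) * (q - M * \<nu>) * s"
    and "rec_down q \<nu> \<beta> M = (1 - M) * M * (\<beta> * M - \<nu>) * s"
    by (simp_all add: rec_A_def rec_up_def rec_C_def rec_down_def r_def s_def)
  with r s show ?thesis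
    by algebra
qed

text \<open>The shifts m + 1 and m - 1 appear as \<open>M * q\<close> and \<open>M / q\<close>. They
  change only the end factors of the two shifted factorials, so all terms share the factor
  \<open>V\<close> below and a polynomial identity in M and \<open>J\<close> remains.\<close>

lemma qhahn_coeff_rec:
  assumes "q > 0" and "q \<noteq> 1" and "M \<noteq> 0"
    and "qpoch \<nu> q (Suc j) \<noteq> 0"
    and R1: "1 - \<beta> * M\<^sup>2 * q \<noteq> 0" and R2: "q - \<beta> * M\<^sup>2 \<noteq> 0"
  shows "rec_up q \<nu> \<beta> M * qhahn_coeff q \<nu> \<beta> (M * q) (Suc j)
         - (rec_A q \<nu> \<beta> M + rec_C q \<nu> \<beta> M - (1 - \<beta> * M\<^sup>2)) * qhahn_coeff q \<nu> \<beta> M (Suc j)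
         + rec_down q \<nu> \<beta> M * qhahn_coeff q \<nu> \<beta> (M / q) (Suc j)
         = (1 - \<beta> * M\<^sup>2) * qhahn_coeff q \<nu> \<beta> M j"
proof -
  define X Y J W r s where "X = qpoch (1 / M) q j" and "Y = qpoch (\<beta> * M) q j"
    and "J = q ^ j" and "W = qpoch \<nu> q j * qpoch q q j"
    and "r = 1 / (1 - \<beta> * M\<^sup>2 * q)" and "s = 1 / (q - \<beta> * M\<^sup>2)"
  define t V where "t = 1 / (W * (1 - \<nu> * J) * (1 - q * J))" and "V = X * Y * J * t"
  define g h where "g = 1 / M" and "h = 1 / q"
  have r: "r * (1 - \<beta> * M\<^sup>2 * q) = 1" and s: "s * (q - \<beta> * M\<^sup>2) = 1"
    and g: "g * M = 1" and h: "h * q = 1"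
    using R1 R2 assms(1,3) by (simp_all add: r_def s_def g_def h_def)
  have W0: "W \<noteq> 0" "1 - \<nu> * J \<noteq> 0" "1 - q * J \<noteq> 0"
    using assms(4) qpoch_self_nonzero[OF assms(1,2), of "Suc j"]
    by (auto simp: qpoch_Suc W_def J_def)
  have coeff: "qhahn_coeff q \<nu> \<beta> M' (Suc j)
      = qpoch (1 / M') q (Suc j) * qpoch (\<beta> * M') q (Suc j) * t * (q * J)" for M'
    by (simp add: qhahn_coeff_def qpoch_Suc W_def J_def t_def)
  have u1: "qpoch (1 / (M * q)) q (Suc j) = (1 - g * h) * X"
    using assms(1) by (simp add: qpoch_Suc_shift X_def g_def h_def)
  \<comment> \<open>\<open>1 - \<beta> * M\<close> and \<open>1 - g\<close> may vanish, so
    \<open>u2\<close> and \<open>d1\<close> keep them as multipliers instead of dividing.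
    \<open>rec_up\<close> contains the first, and \<open>rec_down\<close> the second because 1 - M =
    - M (1 - g).\<close>
  have u2: "(1 - \<beta> * M) * qpoch (\<beta> * (M * q)) q (Suc j) = Y * (1 - \<beta> * M * J) * (1 - \<beta> * M * J * q)"
    unfolding Y_def J_def mult.assoc[symmetric] qpoch_Suc_shift[symmetric]
    by (simp add: qpoch_Suc mult_ac)
  have m1: "qpoch (1 / M) q (Suc j) = X * (1 - J * g)"
    by (simp add: qpoch_Suc X_def J_def g_def)
  have m2: "qpoch (\<beta> * M) q (Suc j) = Y * (1 - \<beta> * M * J)"
    by (simp add: qpoch_Suc Y_def J_def)
  have "(1 - g) * qpoch (g * q) q (Suc j) = X * (1 - J * g) * (1 - J * q * g)"
    unfolding qpoch_Suc_shift[symmetric] by (simp add: qpoch_Suc X_def J_def g_def mult_ac)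
  then have d1: "(1 - g) * qpoch (1 / (M / q)) q (Suc j) = X * (1 - J * g) * (1 - J * q * g)"
    by (simp add: g_def)
  have d2: "qpoch (\<beta> * (M / q)) q (Suc j) = (1 - \<beta> * M * h) * Y"
    using assms(1) by (simp add: qpoch_Suc_shift Y_def h_def)
  have up: "rec_up q \<nu> \<beta> M = - (M * (1 - \<beta> * M) * (1 - M * \<nu>) * r)"
    and down: "rec_down q \<nu> \<beta> M = (1 - M) * M * (\<beta> * M - \<nu>) * s"
    by (simp_all add: rec_up_def rec_down_def r_def s_def)
  have e1: "rec_up q \<nu> \<beta> M * qhahn_coeff q \<nu> \<beta> (M * q) (Suc j)
      = - (V * (1 - M * \<nu>) * r * (M * q - 1) * (1 - \<beta> * M * J) * (1 - \<beta> * M * J * q))"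
    unfolding coeff up using u1 u2 g h V_def by algebra
  have e2: "rec_down q \<nu> \<beta> M * qhahn_coeff q \<nu> \<beta> (M / q) (Suc j)
      = - (V * (\<beta> * M - \<nu>) * s * (M - J) * (M - J * q) * (q - \<beta> * M))"
    unfolding coeff down using d1 d2 g h V_def by algebra
  have e3: "M * qhahn_coeff q \<nu> \<beta> M (Suc j) = V * q * (M - J) * (1 - \<beta> * M * J)"
    unfolding coeff m1 m2 using g V_def by algebra
  have e4: "qhahn_coeff q \<nu> \<beta> M j = V * (1 - \<nu> * J) * (1 - q * J)"
    using W0 by (simp add: qhahn_coeff_def V_def X_def Y_def J_def W_def t_def)
  have A: "rec_A q \<nu> \<beta> M = - (M\<^sup>2 * (1 - \<beta> * M) * (\<beta> * M * q - \<nu>) * r)"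
    and C: "rec_C q \<nu> \<beta> M = (1 - M) * (q - M * \<nu>) * s"
    by (simp_all add: rec_A_def rec_C_def r_def s_def)
  \<comment> \<open>The extra factor M absorbs the 1/M that the middle coefficient would contain,
    see \<open>e3\<close>.\<close>
  have "M * (rec_up q \<nu> \<beta> M * qhahn_coeff q \<nu> \<beta> (M * q) (Suc j)
         - (rec_A q \<nu> \<beta> M + rec_C q \<nu> \<beta> M - (1 - \<beta> * M\<^sup>2)) * qhahn_coeff q \<nu> \<beta> M (Suc j)
         + rec_down q \<nu> \<beta> M * qhahn_coeff q \<nu> \<beta> (M / q) (Suc j))
      = M * ((1 - \<beta> * M\<^sup>2) * qhahn_coeff q \<nu> \<beta> M j)"
    using e3 r s unfolding e1 e2 e4 A C by algebra
  then show ?thesis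
    using assms(3) by simp
qed

text \<open>Coefficients are compared termwise: \<open>rec_sum\<close> for k = 0,
  \<open>qhahn_coeff_rec\<close> for k = j + 1. The disjunction in the last hypothesis is for index
  N + 1 when \<nu> = q^(-N): there the shifted factorial of \<nu> is 0, and only a vanishing \<phi>
  saves the term.\<close>

lemma qhahn_sum_rec:
  fixes \<phi> :: "nat \<Rightarrow> real"
  assumes "q > 0" and "q \<noteq> 1" and "M \<noteq> 0"
    and R1: "1 - \<beta> * M\<^sup>2 * q \<noteq> 0" and R2: "q - \<beta> * M\<^sup>2 \<noteq> 0"
    and \<phi>: "\<And>j. j \<le> m \<Longrightarrow> qpoch \<nu> q (Suc j) \<noteq> 0 \<or> \<phi> (Suc j) = 0"
  shows "rec_up q \<nu> \<beta> M * (\<Sum>k\<le>Suc m. qhahn_coeff q \<nu> \<beta> (M * q) k * \<phi> k)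
         - (rec_A q \<nu> \<beta> M + rec_C q \<nu> \<beta> M - (1 - \<beta> * M\<^sup>2))
             * (\<Sum>k\<le>Suc m. qhahn_coeff q \<nu> \<beta> M k * \<phi> k)
         + rec_down q \<nu> \<beta> M * (\<Sum>k\<le>Suc m. qhahn_coeff q \<nu> \<beta> (M / q) k * \<phi> k)
         = (1 - \<beta> * M\<^sup>2) * (\<Sum>k\<le>m. qhahn_coeff q \<nu> \<beta> M k * \<phi> (Suc k))"
    (is "?u * _ - ?B * _ + ?d * _ = ?Q * _")
proof -
  define F where "F k = (?u * qhahn_coeff q \<nu> \<beta> (M * q) k - ?B * qhahn_coeff q \<nu> \<beta> M k
    + ?d * qhahn_coeff q \<nu> \<beta> (M / q) k) * \<phi> k" for k
  have "F 0 = 0"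
    using rec_sum[OF R1 R2, of \<nu>] by (simp add: F_def)
  have "F (Suc j) = ?Q * (qhahn_coeff q \<nu> \<beta> M j * \<phi> (Suc j))" if "j \<le> m" for j
    using \<phi>[OF that] qhahn_coeff_rec[OF assms(1-3) _ R1 R2, of \<nu> j] by (auto simp: F_def)
  then have "(\<Sum>k\<le>m. F (Suc k)) = (\<Sum>k\<le>m. ?Q * (qhahn_coeff q \<nu> \<beta> M k * \<phi> (Suc k)))"
    by (intro sum.cong) auto
  then have "(\<Sum>k\<le>Suc m. F k) = ?Q * (\<Sum>k\<le>m. qhahn_coeff q \<nu> \<beta> M k * \<phi> (Suc k))"
    unfolding sum.atMost_Suc_shift \<open>F 0 = 0\<close> by (simp add: sum_distrib_left)
  moreover have "(\<Sum>k\<le>Suc m. F k) = ?u * (\<Sum>k\<le>Suc m. qhahn_coeff q \<nu> \<beta> (M * q) k * \<phi> k)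
      - ?B * (\<Sum>k\<le>Suc m. qhahn_coeff q \<nu> \<beta> M k * \<phi> k)
      + ?d * (\<Sum>k\<le>Suc m. qhahn_coeff q \<nu> \<beta> (M / q) k * \<phi> k)"
    unfolding sum_distrib_left sum_subtractf[symmetric] sum.distrib[symmetric] F_def
    by (intro sum.cong refl) (simp only: distrib_right left_diff_distrib mult.assoc)
  ultimately show ?thesis
    by simp
qed

section \<open>Contiguity of the ratios \<phi>_k in the parameter \<alpha>\<close>

lemma qpoch_ratio_diff:
  assumes "qpoch (\<alpha> * u) q (Suc k) \<noteq> 0"
  shows "(1 - \<alpha>) * (qpoch u q k / qpoch (\<alpha> * u * q) q k)
         = (1 - \<alpha> * u) * (qpoch u q k / qpoch (\<alpha> * u) q k
             - \<alpha> * (qpoch u q (Suc k) / qpoch (\<alpha> * u) q (Suc k)))"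
proof -
  have nz: "qpoch (\<alpha> * u) q k \<noteq> 0" "1 - \<alpha> * u * q ^ k \<noteq> 0" "1 - \<alpha> * u \<noteq> 0"
    using assms qpoch_Suc_shift[of "\<alpha> * u" q k] by (auto simp: qpoch_Suc)
  \<comment> \<open>Over the common denominator the numerator is (1 - \<alpha> u q^k) - \<alpha> (1
    - u q^k) = 1 - \<alpha>, free of q^k.\<close>
  have "qpoch u q k / qpoch (\<alpha> * u) q k - \<alpha> * (qpoch u q (Suc k) / qpoch (\<alpha> * u) q (Suc k))
      = (1 - \<alpha>) * qpoch u q k / qpoch (\<alpha> * u) q (Suc k)"
    using nz by (simp add: qpoch_Suc divide_simps) (simp add: algebra_simps)
  also have "\<dots> = (1 - \<alpha>) * qpoch u q k / ((1 - \<alpha> * u) * qpoch (\<alpha> * u * q) q k)"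
    by (simp only: qpoch_Suc_shift)
  finally show ?thesis
    using nz(3) by simp
qed

text \<open>Facts \<open>1\<close> and \<open>2\<close> turn every term into a multiple of
  \<open>qpoch u q k / qpoch (\<alpha> * u * q) q k\<close>; what remains is again (1 - \<alpha> u
  q^k) - \<alpha> (1 - u q^k) = 1 - \<alpha>.\<close>

lemma qpoch_ratio_contiguous:
  assumes "qpoch (\<alpha> * u) q (Suc k) \<noteq> 0"
  shows "(1 - \<alpha>) * (qpoch u q k / qpoch (\<alpha> * u * q) q k)
         = (1 - \<alpha> * u) * (qpoch u q k / qpoch (\<alpha> * u) q k)
           - \<alpha> * (1 - u) * (qpoch (u * q) q k / qpoch (\<alpha> * u * q) q k)"
proof -
  have 1: "(1 - \<alpha> * u) * qpoch (\<alpha> * u * q) q k = qpoch (\<alpha> * u) q k * (1 - \<alpha> * u * q ^ k)"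
    unfolding qpoch_Suc_shift[symmetric] qpoch_Suc ..
  have 2: "(1 - u) * qpoch (u * q) q k = qpoch u q k * (1 - u * q ^ k)"
    unfolding qpoch_Suc_shift[symmetric] qpoch_Suc ..
  have nz: "qpoch (\<alpha> * u) q k \<noteq> 0" "qpoch (\<alpha> * u * q) q k \<noteq> 0"
    using assms qpoch_Suc_shift[of "\<alpha> * u" q k] by (auto simp: qpoch_Suc)
  define z X Y where "z = q ^ k" and "X = 1 / qpoch (\<alpha> * u) q k" and "Y = 1 / qpoch (\<alpha> * u * q) q k"
  have "(1 - \<alpha> * u) * X = (1 - \<alpha> * u * z) * Y"
    using nz 1 unfolding X_def Y_def z_def by (simp add: field_simps)
  then have "(1 - \<alpha>) * (qpoch u q k * Y)
         = (1 - \<alpha> * u) * (qpoch u q k * X) - \<alpha> * (1 - u) * (qpoch (u * q) q k * Y)"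
    using 2[folded z_def] by algebra
  then show ?thesis
    by (simp add: X_def Y_def)
qed

section \<open>Prefactors and translation from powers of q to \<nu>, \<beta>, M\<close>

definition qhahn_prefactor :: "real \<Rightarrow> nat \<Rightarrow> real \<Rightarrow> nat \<Rightarrow> real" where
  "qhahn_prefactor q N b m = q powr (real m * (real N - real m - b))
     * (qpoch (q powr (- real N)) q m / qpoch (q powr (- real m - b)) q m)"

text \<open>The coefficients with k > m vanish, since the shifted factorial of q^(-m) does. The free
  bound \<open>L\<close> lets the sums for m - 1, m and m + 1 run over one range.\<close>

lemma qhahn_U_eq:
  assumes "q > 0" and "m \<le> L"
  shows "qhahn_U q N b m x a = qhahn_prefactor q N b m
    * (\<Sum>k\<le>L. qhahn_coeff q (q powr (- real N)) (q powr (b - real N)) (q ^ m) k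
         * (qpoch (q powr (- x)) q k / qpoch (q powr (a - x)) q k))"
proof -
  have M: "q powr (- real m) = 1 / q ^ m" "q powr (b + real m - real N) = q powr (b - real N) * q ^ m"
    using assms(1) by (simp_all add: powr_minus powr_realpow divide_inverse powr_diff powr_add)
  have "qhahn_coeff q (q powr (- real N)) (q powr (b - real N)) (q ^ m) k = 0" if "m < k" for k
    using that assms(1) qpoch_eq_0[of "1 / q ^ m" q m k] by (simp add: qhahn_coeff_def)
  then have "(\<Sum>k\<le>L. qhahn_coeff q (q powr (- real N)) (q powr (b - real N)) (q ^ m) k
         * (qpoch (q powr (- x)) q k / qpoch (q powr (a - x)) q k))
     = (\<Sum>k=0..m. qhahn_coeff q (q powr (- real N)) (q powr (b - real N)) (q ^ m) k
         * (qpoch (q powr (- x)) q k / qpoch (q powr (a - x)) q k))"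
    using assms(2) by (intro sum.mono_neutral_right) auto
  then show ?thesis
    by (simp add: qhahn_U_def qhahn_prefactor_def qhahn_coeff_def M mult_ac)
qed

lemma powr_parameters:
  fixes q b :: real and N m :: nat
  assumes "q > 0"
  defines "\<nu> \<equiv> q powr (- real N)" and "\<beta> \<equiv> q powr (b - real N)" and "M \<equiv> q ^ m"
  shows "q powr (real m + b - real N) = \<beta> * M"
    and "q powr (- real m - b) = \<nu> / (\<beta> * M)"
    and "q powr (- real m - b - 1) = \<nu> / (\<beta> * M * q)"
    and "q powr (2 * real m + b - real N) = \<beta> * M\<^sup>2"
    and "q powr (2 * real m + b - real N - 1) = \<beta> * M\<^sup>2 / q"
    and "q powr (real N - 2 * real m - b - 1) = 1 / (\<beta> * M\<^sup>2 * q)"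
proof -
  have 2: "q powr (2 * real m) = M\<^sup>2"
    using assms(1) powr_realpow[of q "2 * m"] by (simp add: M_def power_mult mult.commute)
  have 1: "q powr real m = M"
    using assms(1) by (simp add: M_def powr_realpow)
  show "q powr (real m + b - real N) = \<beta> * M" "q powr (- real m - b) = \<nu> / (\<beta> * M)"
    "q powr (- real m - b - 1) = \<nu> / (\<beta> * M * q)" "q powr (2 * real m + b - real N) = \<beta> * M\<^sup>2"
    "q powr (2 * real m + b - real N - 1) = \<beta> * M\<^sup>2 / q"
    "q powr (real N - 2 * real m - b - 1) = 1 / (\<beta> * M\<^sup>2 * q)"
    using assms(1) 1 2 unfolding \<nu>_def \<beta>_def
    by (simp_all add: powr_diff powr_add powr_minus divide_inverse mult_ac)
qed

lemma qhahn_A_eq: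
  assumes "q > 0" and "q \<noteq> 1" and "qnum q (real N - 2 * real m - b - 1) \<noteq> 0"
  shows "1 - q powr (b - real N) * (q ^ m)\<^sup>2 * q \<noteq> 0"
    and "qhahn_A q N a b m
         = q powr a * rec_A q (q powr (- real N)) (q powr (b - real N)) (q ^ m) / (1 - q)"
proof -
  define \<nu> \<beta> M where "\<nu> = q powr (- real N)" and "\<beta> = q powr (b - real N)" and "M = q ^ m"
  have nz: "1 - q \<noteq> 0" "\<beta> \<noteq> 0" "M \<noteq> 0" "q \<noteq> 0"
    using assms by (auto simp: \<beta>_def M_def)
  note p = powr_parameters[OF assms(1), where m = m and b = b and N = N, folded \<nu>_def \<beta>_def M_def]
  show R: "1 - \<beta> * M\<^sup>2 * q \<noteq> 0"
    using assms(3) by (auto simp: qnum_def p)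
  have "(1 - \<nu> / (\<beta> * M * q)) * M * (\<beta> * M\<^sup>2 * q) = M\<^sup>2 * (\<beta> * M * q - \<nu>)"
    using nz by (simp add: field_simps power2_eq_square)
  \<comment> \<open>The denominator of A_m contains the inverse of \<beta> M^2 q; clearing it
    produces the minus sign in \<open>rec_A\<close>.\<close>
  moreover have "1 - 1 / (\<beta> * M\<^sup>2 * q) = - ((1 - \<beta> * M\<^sup>2 * q) / (\<beta> * M\<^sup>2 * q))"
    using nz by (simp add: field_simps)
  ultimately have "M * (1 - \<nu> / (\<beta> * M * q)) / (1 - 1 / (\<beta> * M\<^sup>2 * q))
      = - (M\<^sup>2 * (\<beta> * M * q - \<nu>) / (1 - \<beta> * M\<^sup>2 * q))"
    by (simp add: mult_ac)
  then have "M * (1 - \<nu> / (\<beta> * M * q)) / (1 - 1 / (\<beta> * M\<^sup>2 * q)) * (1 - \<beta> * M) = rec_A q \<nu> \<beta> M"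
    by (simp add: rec_A_def)
  moreover have "qhahn_A q N a b m
      = q powr a * (M * (1 - \<nu> / (\<beta> * M * q)) / (1 - 1 / (\<beta> * M\<^sup>2 * q)) * (1 - \<beta> * M)) / (1 - q)"
    using assms(1) nz(1) unfolding qhahn_A_def qnum_def p powr_add powr_realpow[OF assms(1)] M_def[symmetric]
    by (simp add: mult_ac)
  ultimately show "qhahn_A q N a b m = q powr a * rec_A q \<nu> \<beta> M / (1 - q)"
    by simp
qed

lemma qhahn_C_eq:
  assumes "q > 0" and "q \<noteq> 1" and "qnum q (2 * real m + b - real N - 1) \<noteq> 0"
  shows "q - q powr (b - real N) * (q ^ m)\<^sup>2 \<noteq> 0"
    and "qhahn_C q N a b m
         = q powr a * rec_C q (q powr (- real N)) (q powr (b - real N)) (q ^ m) / (1 - q)"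
proof -
  define \<nu> \<beta> M where "\<nu> = q powr (- real N)" and "\<beta> = q powr (b - real N)" and "M = q ^ m"
  have nz: "1 - q \<noteq> 0" "q \<noteq> 0"
    using assms by auto
  note p = powr_parameters[OF assms(1), where m = m and b = b and N = N, folded \<nu>_def \<beta>_def M_def]
  have p': "q powr (real m - real N - 1) = M * \<nu> / q"
    using assms(1) unfolding M_def \<nu>_def
    by (simp add: powr_diff powr_minus powr_realpow divide_inverse)
  show R: "q - \<beta> * M\<^sup>2 \<noteq> 0"
    using assms(3) nz by (auto simp: qnum_def p)
  have "(1 - M * \<nu> / q) / (1 - \<beta> * M\<^sup>2 / q) = (q - M * \<nu>) / (q - \<beta> * M\<^sup>2)"
    using nz R by (simp add: divide_simps)
  moreover have "qhahn_C q N a b m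
      = q powr a * ((1 - M) * ((1 - M * \<nu> / q) / (1 - \<beta> * M\<^sup>2 / q))) / (1 - q)"
    using nz(1) unfolding qhahn_C_def qnum_def p p' powr_realpow[OF assms(1)] M_def[symmetric]
    by simp
  ultimately show "qhahn_C q N a b m = q powr a * rec_C q \<nu> \<beta> M / (1 - q)"
    by (simp add: rec_C_def)
qed

text \<open>The ratio of consecutive prefactors, stated without division so that it also covers m =
  N. There both sides are 0, and no denominator condition at N + 1 is required.\<close>

lemma qhahn_prefactor_Suc:
  fixes q b :: real and N m :: nat
  assumes "q > 0" and "m \<le> N"
    and "m < N \<Longrightarrow> qpoch (q powr (- real (Suc m) - b)) q (Suc m) \<noteq> 0"
  defines "\<nu> \<equiv> q powr (- real N)" and "\<beta> \<equiv> q powr (b - real N)" and "M \<equiv> q ^ m"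
  shows "M * (\<beta> * M * q - \<nu>) * qhahn_prefactor q N b (Suc m)
         = (1 - M * \<nu>) * qhahn_prefactor q N b m"
proof (cases "m = N")
  case True
  then have "\<nu> * M = 1"
    using assms(1) by (simp add: \<nu>_def M_def powr_minus powr_realpow)
  moreover from this have "qpoch \<nu> q (Suc m) = 0"
    by (simp add: qpoch_Suc M_def)
  ultimately show ?thesis
    by (simp add: qhahn_prefactor_def mult.commute flip: \<nu>_def)
next
  case False
  define e where "e = \<nu> / (\<beta> * M * q)"
  have nz: "\<beta> \<noteq> 0" "M \<noteq> 0" "q \<noteq> 0"
    using assms(1) by (auto simp: \<beta>_def M_def)
  note p = powr_parameters[OF assms(1), where m = m and b = b and N = N, folded \<nu>_def \<beta>_def M_def]
  have e: "q powr (- real (Suc m) - b) = e"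
    using p(3) unfolding e_def by (metis of_nat_Suc minus_add_distrib diff_diff_eq add.commute uminus_add_conv_diff)
  have eq: "e * q = q powr (- real m - b)"
    using nz(3) by (simp add: e_def p(2))
  \<comment> \<open>The base of this factorial moves with m, so the new factor \<open>1 - e\<close>
    enters at the front rather than at the end.\<close>
  have den: "qpoch (q powr (- real (Suc m) - b)) q (Suc m) = (1 - e) * qpoch (q powr (- real m - b)) q m"
    unfolding e qpoch_Suc_shift eq ..
  have "1 - e \<noteq> 0"
    using assms(2,3) False den by auto
  have "real (Suc m) * (real N - real (Suc m) - b)
      = real m * (real N - real m - b) + (real N - 2 * real m - b - 1)"
    by (simp add: algebra_simps)
  then have pow: "q powr (real (Suc m) * (real N - real (Suc m) - b))
      = q powr (real m * (real N - real m - b)) * (1 / (\<beta> * M\<^sup>2 * q))"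
    by (simp only: powr_add p)
  have "qhahn_prefactor q N b (Suc m)
      = 1 / (\<beta> * M\<^sup>2 * q) * ((1 - \<nu> * M) / (1 - e)) * qhahn_prefactor q N b m"
    unfolding qhahn_prefactor_def den pow qpoch_Suc[of "q powr (- real N)"]
    by (simp add: mult_ac flip: \<nu>_def M_def)
  moreover have "M * (\<beta> * M * q - \<nu>) = (\<beta> * M\<^sup>2 * q) * (1 - e)"
    using nz by (simp add: e_def field_simps power2_eq_square)
  ultimately show ?thesis
    using nz \<open>1 - e \<noteq> 0\<close> by (simp add: mult.commute)
qed

text \<open>Trades the prefactor of U_(m+1) for that of U_m; together with
  \<open>rec_C_prefactor\<close> this puts all three terms of the recurrence over one
  prefactor.\<close>

lemma rec_A_prefactor:
  assumes "q > 0" and "m \<le> N"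
    and "m < N \<Longrightarrow> qpoch (q powr (- real (Suc m) - b)) q (Suc m) \<noteq> 0"
  shows "rec_A q (q powr (- real N)) (q powr (b - real N)) (q ^ m) * qhahn_prefactor q N b (Suc m)
         = rec_up q (q powr (- real N)) (q powr (b - real N)) (q ^ m) * qhahn_prefactor q N b m"
proof -
  define \<nu> \<beta> M where "\<nu> = q powr (- real N)" and "\<beta> = q powr (b - real N)" and "M = q ^ m"
  define P P' r where "P = qhahn_prefactor q N b m" and "P' = qhahn_prefactor q N b (Suc m)"
    and "r = 1 / (1 - \<beta> * M\<^sup>2 * q)"
  have "M * (\<beta> * M * q - \<nu>) * P' = (1 - M * \<nu>) * P"
    using qhahn_prefactor_Suc[OF assms] by (simp add: \<nu>_def \<beta>_def M_def P_def P'_def)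
  then have "- (M\<^sup>2 * (1 - \<beta> * M) * (\<beta> * M * q - \<nu>) * r) * P' = - (M * (1 - \<beta> * M) * (1 - M * \<nu>) * r) * P"
    by algebra
  then have "rec_A q \<nu> \<beta> M * P' = rec_up q \<nu> \<beta> M * P"
    by (simp add: rec_A_def rec_up_def r_def)
  then show ?thesis
    by (simp add: \<nu>_def \<beta>_def M_def P_def P'_def)
qed

lemma rec_C_prefactor:
  assumes "q > 0" and "Suc m \<le> N" and "qpoch (q powr (- real (Suc m) - b)) q (Suc m) \<noteq> 0"
  shows "rec_C q (q powr (- real N)) (q powr (b - real N)) (q ^ Suc m) * qhahn_prefactor q N b m
         = rec_down q (q powr (- real N)) (q powr (b - real N)) (q ^ Suc m) * qhahn_prefactor q N b (Suc m)"
proof -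
  define \<nu> \<beta> M where "\<nu> = q powr (- real N)" and "\<beta> = q powr (b - real N)" and "M = q ^ m"
  define P P' r where "P = qhahn_prefactor q N b m" and "P' = qhahn_prefactor q N b (Suc m)"
    and "r = 1 / (q - \<beta> * (M * q)\<^sup>2)"
  have "M * (\<beta> * M * q - \<nu>) * P' = (1 - M * \<nu>) * P"
    using qhahn_prefactor_Suc[of q m N b] assms by (simp add: \<nu>_def \<beta>_def M_def P_def P'_def)
  then have "(1 - M * q) * (q - M * q * \<nu>) * r * P = (1 - M * q) * (M * q) * (\<beta> * (M * q) - \<nu>) * r * P'"
    by algebra
  then have "rec_C q \<nu> \<beta> (M * q) * P = rec_down q \<nu> \<beta> (M * q) * P'"
    by (simp add: rec_C_def rec_down_def r_def)
  then show ?thesis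
    by (simp add: \<nu>_def \<beta>_def M_def P_def P'_def mult.commute)
qed

lemma qpoch_powr_nonzero:
  assumes "q > 0" and "q \<noteq> 1" and "k \<le> N"
  shows "qpoch (q powr (- real N)) q k \<noteq> 0"
proof -
  have "q powr (- real N) * q ^ i \<noteq> 1" if "i < k" for i
  proof -
    have "q powr (- real N) * q ^ i = q powr (real i - real N)"
      using assms(1) by (simp add: powr_diff powr_minus powr_realpow divide_inverse mult.commute)
    also have "\<dots> \<noteq> 1"
      using that assms powr_eq_one_iff_gen[of q] by auto
    finally show ?thesis .
  qed
  then show ?thesis
    by (simp add: qpoch_def)
qed

(* End terms: for m = 0 the truncated index m - 1 is harmless since C_0 = 0 (qhahn_C_0);
   for m = N, U_{N+1} = 0 (qhahn_U_Suc); for n = 0 the factor [-n]_q is 0. *)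
theorem proposition7p9:
  fixes q a b :: real and N m n :: nat
  assumes "q > 0" and "q \<noteq> 1" and "N \<ge> 1"
    and "\<forall>i\<le>N. qpoch (q powr (- real i - b)) q i \<noteq> 0"
    and "\<forall>j\<le>N. \<forall>k\<le>N. qpoch (q powr (a - real j)) q k \<noteq> 0"
    and "\<forall>j\<le>N. \<forall>k\<le>N. qpoch (q powr (a + 1 - real j)) q k \<noteq> 0"
    and "\<forall>j\<le>N. qnum q (a - real j) \<noteq> 0"
    and "\<forall>i\<le>N. qnum q (real N - 2 * real i - b - 1) \<noteq> 0"
    and "\<forall>i\<le>N. qnum q (2 * real i + b - real N - 1) \<noteq> 0"
    and "m \<le> N" and "n \<le> N"
  shows
    "qnum q a * qhahn_U q N b m (real n) (a + 1)
       = qnum q (a - real n) * qhahn_U q N b m (real n) a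
         - q powr a * qnum q (- real n) * qhahn_U q N b m (real n - 1) a
     \<and>
     - (qnum q a * qnum q (2 * real m + b - real N) / qnum q (a - real n))
         * qhahn_U q N b m (real n) (a + 1)
       = qhahn_A q N a b m * qhahn_U q N b (m + 1) (real n) a
         - (qhahn_A q N a b m + qhahn_C q N a b m
            + (1 - q powr a) * qnum q (2 * real m + b - real N)) * qhahn_U q N b m (real n) a
         + qhahn_C q N a b m * qhahn_U q N b (m - 1) (real n) a"
proof -
  define u \<alpha> \<nu> \<beta> M where "u = q powr (- real n)" and "\<alpha> = q powr a"
    and "\<nu> = q powr (- real N)" and "\<beta> = q powr (b - real N)" and "M = q ^ m"
  define P f where "P = qhahn_prefactor q N b" and "f = qhahn_coeff q \<nu> \<beta>"
  define \<phi> where "\<phi> k = qpoch u q k / qpoch (\<alpha> * u) q k" for k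
  define \<psi> where "\<psi> k = qpoch u q k / qpoch (\<alpha> * u * q) q k" for k
  have q: "q > 0" "q \<noteq> 1" "1 - q \<noteq> 0"
    using assms(1,2) by auto
  \<comment> \<open>Raising a by 1 and lowering n by 1 lead to the same denominator base \<alpha> u
    q.\<close>
  have au: "q powr (a - real n) = \<alpha> * u" "q powr (a + 1 - real n) = \<alpha> * u * q"
    "q powr (a - (real n - 1)) = \<alpha> * u * q" "q powr (- (real n - 1)) = u * q"
    using q(1) by (simp_all add: \<alpha>_def u_def powr_diff powr_add powr_minus divide_inverse)
  have Q: "q powr (2 * real m + b - real N) = \<beta> * M\<^sup>2"
    using powr_parameters(4)[OF q(1)] by (simp add: \<beta>_def M_def)
  have au1: "1 - \<alpha> * u \<noteq> 0"
    using assms(7,11) by (auto simp: qnum_def au)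
  \<comment> \<open>Length k + 1 can be N + 1, beyond the hypothesis for a. The front factor 1 -
    \<alpha> u is nonzero by [a-n]_q \<noteq> 0, and the remaining k factors are covered by the
    hypothesis for a + 1.\<close>
  have nz: "qpoch (\<alpha> * u) q (Suc k) \<noteq> 0" if "k \<le> m" for k
    using assms(6,10,11) that au1 by (auto simp: qpoch_Suc_shift simp flip: au(2))
  \<comment> \<open>The range up to m + 1 fits the recurrence, the range up to m the comparison with
    U_m(n; a+1).\<close>
  have Un: "qhahn_U q N b m (real n) a = P m * (\<Sum>k\<le>Suc m. f M k * \<phi> k)"
    "qhahn_U q N b m (real n) a = P m * (\<Sum>k\<le>m. f M k * \<phi> k)"
    using qhahn_U_eq[OF q(1), of m "Suc m" N b "real n" a] qhahn_U_eq[OF q(1), of m m N b "real n" a]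
    unfolding P_def f_def \<phi>_def au M_def \<nu>_def \<beta>_def u_def[symmetric] by auto
  have Ua: "qhahn_U q N b m (real n) (a + 1) = P m * (\<Sum>k\<le>m. f M k * \<psi> k)"
    using qhahn_U_eq[OF q(1), of m m N b "real n" "a + 1"]
    unfolding P_def f_def \<psi>_def au M_def \<nu>_def \<beta>_def u_def[symmetric] by simp
  have Um: "qhahn_U q N b m (real n - 1) a
      = P m * (\<Sum>k\<le>m. f M k * (qpoch (u * q) q k / qpoch (\<alpha> * u * q) q k))"
    using qhahn_U_eq[OF q(1), of m m N b "real n - 1" a]
    unfolding P_def f_def au M_def \<nu>_def \<beta>_def by simp

  have "(1 - \<alpha>) * (\<Sum>k\<le>m. f M k * \<psi> k) = (1 - \<alpha> * u) * (\<Sum>k\<le>m. f M k * \<phi> k)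
      - \<alpha> * (1 - u) * (\<Sum>k\<le>m. f M k * (qpoch (u * q) q k / qpoch (\<alpha> * u * q) q k))"
    unfolding sum_distrib_left sum_subtractf[symmetric]
  proof (intro sum.cong refl)
    fix k assume "k \<in> {..m}"
    then have "(1 - \<alpha>) * \<psi> k = (1 - \<alpha> * u) * \<phi> k
      - \<alpha> * (1 - u) * (qpoch (u * q) q k / qpoch (\<alpha> * u * q) q k)"
      using qpoch_ratio_contiguous[OF nz, of k] unfolding \<phi>_def \<psi>_def by simp
    then show "(1 - \<alpha>) * (f M k * \<psi> k) = (1 - \<alpha> * u) * (f M k * \<phi> k)
      - \<alpha> * (1 - u) * (f M k * (qpoch (u * q) q k / qpoch (\<alpha> * u * q) q k))"
      by algebra
  qed
  then have first: "(1 - \<alpha>) * qhahn_U q N b m (real n) (a + 1) = (1 - \<alpha> * u) * qhahn_U q N b m (real n) a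
      - \<alpha> * (1 - u) * qhahn_U q N b m (real n - 1) a"
    unfolding Ua Un(2) Um by algebra

  define S T where "S = (\<Sum>k\<le>Suc m. f M k * \<phi> k)" and "T = (\<Sum>k\<le>m. f M k * \<phi> (Suc k))"
  \<comment> \<open>For the second relation, U_m(n; a+1) is expanded in the \<phi>_k;
    \<open>T\<close> collects the terms with shifted index.\<close>
  have "(1 - \<alpha>) * (\<Sum>k\<le>m. f M k * \<psi> k) = (1 - \<alpha> * u) * ((\<Sum>k\<le>m. f M k * \<phi> k) - \<alpha> * T)"
    unfolding sum_distrib_left sum_subtractf[symmetric] T_def
  proof (intro sum.cong refl)
    fix k assume "k \<in> {..m}"
    then have "(1 - \<alpha>) * \<psi> k = (1 - \<alpha> * u) * (\<phi> k - \<alpha> * \<phi> (Suc k))"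
      using qpoch_ratio_diff[OF nz, of k] unfolding \<phi>_def \<psi>_def by simp
    then show "(1 - \<alpha>) * (f M k * \<psi> k) = (1 - \<alpha> * u) * (f M k * \<phi> k - \<alpha> * (f M k * \<phi> (Suc k)))"
      by algebra
  qed
  then have shift: "(1 - \<alpha>) * qhahn_U q N b m (real n) (a + 1) = (1 - \<alpha> * u) * (P m * (S - \<alpha> * T))"
    using Un unfolding S_def[symmetric] Ua by algebra
  have R1: "1 - \<beta> * M\<^sup>2 * q \<noteq> 0" and A: "qhahn_A q N a b m = \<alpha> * rec_A q \<nu> \<beta> M / (1 - q)"
    using qhahn_A_eq[OF q(1,2)] assms(8,10) unfolding \<beta>_def M_def \<nu>_def \<alpha>_def by blast+
  have R2: "q - \<beta> * M\<^sup>2 \<noteq> 0" and C: "qhahn_C q N a b m = \<alpha> * rec_C q \<nu> \<beta> M / (1 - q)"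
    using qhahn_C_eq[OF q(1,2)] assms(9,10) unfolding \<beta>_def M_def \<nu>_def \<alpha>_def by blast+
  \<comment> \<open>The critical index is j = N: there (u; q)_(N+1) = 0 because u q^n = 1 with n
    \<le> N.\<close>
  have \<phi>: "qpoch \<nu> q (Suc j) \<noteq> 0 \<or> \<phi> (Suc j) = 0" if "j \<le> m" for j
  proof (cases "j < N")
    case True
    then show ?thesis
      using qpoch_powr_nonzero[OF q(1,2), of "Suc j" N] by (simp add: \<nu>_def)
  next
    case False
    then have "n < Suc j"
      using assms(11) by simp
    moreover have "u * q ^ n = 1"
      using q(1) by (simp add: u_def powr_minus powr_realpow)
    ultimately show ?thesis
      using qpoch_eq_0 by (simp add: \<phi>_def)
  qed
  have M: "M \<noteq> 0"
    using q by (simp add: M_def)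
  define S1 S2 where "S1 = (\<Sum>k\<le>Suc m. f (M * q) k * \<phi> k)"
    and "S2 = (\<Sum>k\<le>Suc m. f (M / q) k * \<phi> k)"
  have rec: "rec_up q \<nu> \<beta> M * S1 - (rec_A q \<nu> \<beta> M + rec_C q \<nu> \<beta> M - (1 - \<beta> * M\<^sup>2)) * S
      + rec_down q \<nu> \<beta> M * S2 = (1 - \<beta> * M\<^sup>2) * T"
    using qhahn_sum_rec[OF q(1,2) M R1 R2, of m \<nu> \<phi>] \<phi>
    unfolding S_def T_def S1_def S2_def f_def by blast
  have "qhahn_U q N b (m + 1) (real n) a = P (Suc m) * S1"
    using qhahn_U_eq[OF q(1), of "m + 1" "Suc m" N b "real n" a]
    unfolding P_def f_def \<phi>_def au M_def \<nu>_def \<beta>_def u_def[symmetric] S1_def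
    by (simp add: mult.commute del: sum.atMost_Suc)
  moreover have "rec_A q \<nu> \<beta> M * P (Suc m) = rec_up q \<nu> \<beta> M * P m"
    using rec_A_prefactor[OF q(1) assms(10)] assms(4) Suc_leI
    unfolding P_def M_def \<nu>_def \<beta>_def by blast
  ultimately have up: "rec_A q \<nu> \<beta> M * qhahn_U q N b (m + 1) (real n) a
      = rec_up q \<nu> \<beta> M * (P m * S1)"
    by algebra
  have down: "rec_C q \<nu> \<beta> M * qhahn_U q N b (m - 1) (real n) a
      = rec_down q \<nu> \<beta> M * (P m * S2)"
  proof (cases m)
    \<comment> \<open>Here M = 1, and the factor 1 - M annihilates both sides, whatever
      \<open>m - 1\<close> denotes.\<close>
    case 0
    then show ?thesis
      by (simp add: rec_C_def rec_down_def M_def)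
  next
    case (Suc l)
    have "M / q = q ^ l"
      using q(1) by (simp add: M_def Suc)
    then have "qhahn_U q N b (m - 1) (real n) a = P l * S2"
      using qhahn_U_eq[OF q(1), of l "Suc m" N b "real n" a]
      unfolding P_def f_def \<phi>_def au \<nu>_def \<beta>_def u_def[symmetric] S2_def
      by (simp add: Suc del: sum.atMost_Suc)
    moreover have "rec_C q \<nu> \<beta> M * P l = rec_down q \<nu> \<beta> M * P m"
      using rec_C_prefactor[OF q(1), of l N b] assms(4,10)
      unfolding P_def M_def \<nu>_def \<beta>_def Suc by blast
    ultimately show ?thesis
      by algebra
  qed
  define d where "d = 1 / (1 - q)"
  have d: "x / (1 - q) = x * d" for x
    by (simp add: d_def)
  have num: "qnum q a = (1 - \<alpha>) * d" "qnum q (a - real n) = (1 - \<alpha> * u) * d"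
    "qnum q (- real n) = (1 - u) * d" "qnum q (2 * real m + b - real N) = (1 - \<beta> * M\<^sup>2) * d"
    by (simp_all add: qnum_def d au Q flip: u_def \<alpha>_def)
  have "d \<noteq> 0"
    using q(3) by (simp add: d_def)
  have "- (qnum q a * qnum q (2 * real m + b - real N) / qnum q (a - real n))
        * qhahn_U q N b m (real n) (a + 1)
      = - ((1 - \<beta> * M\<^sup>2) * d * ((1 - \<alpha>) * qhahn_U q N b m (real n) (a + 1)) / (1 - \<alpha> * u))"
    using \<open>d \<noteq> 0\<close> unfolding num by simp
  also have "\<dots> = - ((1 - \<beta> * M\<^sup>2) * d * (P m * (S - \<alpha> * T)))"
    unfolding shift using au1 by simp
  \<comment> \<open>With Q = 1 - \<beta> M^2, the middle coefficient is d (\<alpha> (rec_A + rec_C -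
    Q) + Q). By \<open>rec\<close> the terms carrying \<alpha> add up to d \<alpha> Q P_m T, and the
    last Q leaves - d Q P_m S.\<close>
  also have "\<dots> = qhahn_A q N a b m * qhahn_U q N b (m + 1) (real n) a
         - (qhahn_A q N a b m + qhahn_C q N a b m
            + (1 - q powr a) * qnum q (2 * real m + b - real N)) * qhahn_U q N b m (real n) a
         + qhahn_C q N a b m * qhahn_U q N b (m - 1) (real n) a"
    using up down rec unfolding A C num d Un(1) \<alpha>_def[symmetric] S_def[symmetric]
      S1_def[symmetric] S2_def[symmetric]
    by algebra
  finally have second: "- (qnum q a * qnum q (2 * real m + b - real N) / qnum q (a - real n))
        * qhahn_U q N b m (real n) (a + 1) = \<dots>" .
  have "qnum q a * qhahn_U q N b m (real n) (a + 1)
       = qnum q (a - real n) * qhahn_U q N b m (real n) a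
         - q powr a * qnum q (- real n) * qhahn_U q N b m (real n - 1) a"
    using first unfolding num \<alpha>_def[symmetric] by algebra
  with second show ?thesis
    by blast
qed

end
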